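(* $\tau_E(\mathcal{NC}_n^2) = \frac{n^2}{8} + \Theta(n)$; that is, there exist constants $c_1, c_2 > 0$ such that for all sufficiently large $n$, $\frac{n^2}{8} + c_1 n \le \tau_E(\mathcal{NC}_n^2) \le \frac{n^2}{8} + c_2 n$.
   Context: Let $\mathcal{F}$ be a hypergraph whose vertex set is $E(K_n)$, the edge set of the complete graph on $n$ vertices; its hyperedges are called losing sets. In the unbiased Avoider-Enforcer game on $\mathcal{F}$, two players, Avoider and Enforcer, alternately claim previously unclaimed edges of $K_n$, one edge per turn, with Avoider going first, until all edges are claimed. Enforcer wins if the set of edges claimed by Avoider contains some hyperedge of $\mathcal{F}$; otherwise Avoider wins. $\tau_E(\mathcal{F})$ denotes the smallest integer $t$ such that Enforcer has a strategy guaranteeing that, whatever Avoider does, Avoider's graph contains a hyperedge of $\mathcal{F}$ after at most $t$ moves (rounds); $\tau_E(\mathcal{F})=\infty$ if Avoider wins. $\mathcal{NC}_n^2$ is the hypergraph on $E(K_n)$ whose hyperedges are the edge sets of all non-bipartite graphs on the vertex set of $K_n$; thus Avoider loses as soon as his graph contains an odd cycle. *)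

theory Defs
  imports Complex_Main "HOL-Library.Extended_Real" "HOL-Library.Ramsey"
begin

section \<open>Unbiased Avoider-Enforcer games\<close>

text \<open>
  The board is a finite set \<open>X\<close>, the losing sets form a family \<open>F\<close> of subsets of \<open>X\<close>.
  The course of a game is the list of the elements claimed so far, in order of play. Avoider
  goes first, so he makes the moves at the even positions \<open>0, 2, 4, \<dots>\<close>.
\<close>

definition history :: "'a set \<Rightarrow> 'a list \<Rightarrow> bool" where
  "history X h \<longleftrightarrow> distinct h \<and> set h \<subseteq> X"

definition complete_play :: "'a set \<Rightarrow> 'a list \<Rightarrow> bool" where
  "complete_play X p \<longleftrightarrow> distinct p \<and> set p = X"

text \<open>
  A strategy must answer every history in which it is Enforcer's turn by an unclaimed element.
  (Otherwise a strategy making illegal moves would admit no plays and win vacuously.)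
\<close>

definition enforcer_strategy :: "'a set \<Rightarrow> ('a list \<Rightarrow> 'a) \<Rightarrow> bool" where
  "enforcer_strategy X \<sigma> \<longleftrightarrow>
     (\<forall>h. history X h \<and> odd (length h) \<and> set h \<noteq> X \<longrightarrow> \<sigma> h \<in> X - set h)"

definition follows :: "('a list \<Rightarrow> 'a) \<Rightarrow> 'a list \<Rightarrow> bool" where
  "follows \<sigma> p \<longleftrightarrow> (\<forall>i < length p. odd i \<longrightarrow> p ! i = \<sigma> (take i p))"

text \<open>The elements claimed by Avoider in his first \<open>t\<close> moves.\<close>

definition avoider_claims :: "'a list \<Rightarrow> nat \<Rightarrow> 'a set" where
  "avoider_claims p t = {p ! (2 * i) | i. i < t \<and> 2 * i < length p}"

definition enforcer_wins_within :: "'a set \<Rightarrow> 'a set set \<Rightarrow> nat \<Rightarrow> bool" where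
  "enforcer_wins_within X F t \<longleftrightarrow>
     (\<exists>\<sigma>. enforcer_strategy X \<sigma> \<and>
        (\<forall>p. complete_play X p \<and> follows \<sigma> p \<longrightarrow> (\<exists>H\<in>F. H \<subseteq> avoider_claims p t)))"

text \<open>In \<^typ>\<open>enat\<close> the infimum of the empty set is \<open>\<infinity>\<close>.\<close>

definition tau_E :: "'a set \<Rightarrow> 'a set set \<Rightarrow> enat" where
  "tau_E X F = Inf {enat t | t. enforcer_wins_within X F t}"


section \<open>The non-bipartiteness game on the complete graph\<close>

text \<open>
  Graphs are simple and undirected; an edge is the two-element set of its endpoints.
\<close>

definition complete_graph_edges :: "nat \<Rightarrow> nat set set" where
  "complete_graph_edges n = nsets {..<n} 2"

definition bipartite :: "'v set \<Rightarrow> 'v set set \<Rightarrow> bool" where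
  "bipartite V E \<longleftrightarrow>
     (\<exists>A B. A \<union> B = V \<and> A \<inter> B = {} \<and> (\<forall>e\<in>E. \<exists>a\<in>A. \<exists>b\<in>B. e = {a, b}))"

definition NC2 :: "nat \<Rightarrow> nat set set set" where
  "NC2 n = {E. E \<subseteq> complete_graph_edges n \<and> \<not> bipartite {..<n} E}"

end

theory Submission
  imports Defs
begin

text \<open>
  Enforcer: whenever some unclaimed edge is forced, i.e. lies in every cut containing Avoider's
  graph, he claims such an edge. If there is none, Avoider's next edge is not forced either and
  merges two components of his graph; this happens fewer than \<open>n\<close> times. So while Avoider's graph
  is bipartite, all claimed edges but \<open>O(n)\<close> lie in one cut, which has at most \<open>n\<^sup>2 / 4\<close> edges.

  Avoider: he starts with \<open>r = n div 8\<close> edges at the vertex \<open>0\<close>. A star commits so little that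
  some balanced cut contains it and misses at least \<open>r / 2\<close> of Enforcer's first \<open>r\<close> edges. From then
  on he plays in this cut, and it lasts for \<open>n\<^sup>2 / 4 + r / 2\<close> turns in total.
\<close>

section \<open>Cuts, and bipartite graphs as subgraphs of cuts\<close>

definition cut_edges :: "'v set \<Rightarrow> 'v set \<Rightarrow> 'v set set" where
  "cut_edges V S = (\<lambda>(a, b). {a, b}) ` (S \<times> (V - S))"

lemma pair_in_cut_iff:
  assumes "u \<in> V" "v \<in> V"
  shows "{u, v} \<in> cut_edges V S \<longleftrightarrow> (u \<in> S \<longleftrightarrow> v \<notin> S)"
  using assms by (auto simp: cut_edges_def doubleton_eq_iff image_iff)

lemma card_cut:
  assumes "finite V" "S \<subseteq> V"
  shows "card (cut_edges V S) = card S * (card V - card S)"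
proof -
  have "inj_on (\<lambda>(a, b). {a, b}) (S \<times> (V - S))"
    by (auto simp: inj_on_def doubleton_eq_iff)
  then show ?thesis
    using assms by (simp add: cut_edges_def card_image card_cartesian_product card_Diff_subset finite_subset)
qed

lemma cut_subset_nsets: "S \<subseteq> V \<Longrightarrow> cut_edges V S \<subseteq> nsets V 2"
  by (auto simp: cut_edges_def nsets_def card_2_iff)

text \<open>The two colour classes partition \<open>V\<close>, so either one determines the other. A
  single set \<open>S\<close> therefore suffices, and later arguments speak only of cuts.\<close>

lemma bipartite_iff_cut: "bipartite V E \<longleftrightarrow> (\<exists>S\<subseteq>V. E \<subseteq> cut_edges V S)"
proof
  assume "bipartite V E"
  then obtain A B where AB: "A \<union> B = V" "A \<inter> B = {}"
    "\<forall>e\<in>E. \<exists>a\<in>A. \<exists>b\<in>B. e = {a, b}"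
    unfolding bipartite_def by blast
  then have "B = V - A" by blast
  with AB have "A \<subseteq> V \<and> E \<subseteq> cut_edges V A" by (fastforce simp: cut_edges_def)
  then show "\<exists>S\<subseteq>V. E \<subseteq> cut_edges V S" by blast
next
  assume "\<exists>S\<subseteq>V. E \<subseteq> cut_edges V S"
  then obtain S where S: "S \<subseteq> V" "E \<subseteq> cut_edges V S" by blast
  then have "\<forall>e\<in>E. \<exists>a\<in>S. \<exists>b\<in>V - S. e = {a, b}" by (fastforce simp: cut_edges_def)
  moreover have "S \<union> (V - S) = V" "S \<inter> (V - S) = {}" using S(1) by auto
  ultimately show "bipartite V E" unfolding bipartite_def by metis
qed

lemma bipartite_subset: "bipartite V E \<Longrightarrow> E' \<subseteq> E \<Longrightarrow> bipartite V E'"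
  unfolding bipartite_iff_cut by blast

lemma finite_complete_graph_edges: "finite (complete_graph_edges n)"
  by (simp add: complete_graph_edges_def finite_imp_finite_nsets)

lemma card_complete_graph_edges: "card (complete_graph_edges n) = n choose 2"
  by (simp add: complete_graph_edges_def)

text \<open>The inequality of arithmetic and geometric means for the sizes of the two sides; the
  factor 4 avoids rounding.\<close>

lemma card_cut_le:
  assumes "S \<subseteq> {..<n}"
  shows "4 * card (cut_edges {..<n} S) \<le> n\<^sup>2"
proof -
  let ?s = "card S"
  have "?s \<le> n" using assms card_mono[of "{..<n}" S] by simp
  then obtain d where d: "n = ?s + d" using le_Suc_ex by blast
  have "0 \<le> (int ?s - int d)\<^sup>2" by simp
  then have "4 * (int ?s * int d) \<le> (int ?s + int d)\<^sup>2"
    by (simp add: power2_eq_square algebra_simps)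
  then have "int (4 * (?s * d)) \<le> int ((?s + d)\<^sup>2)" by simp
  then have "4 * (?s * d) \<le> n\<^sup>2" unfolding d[symmetric] by (rule of_nat_le_iff[THEN iffD1])
  moreover have "card (cut_edges {..<n} S) = ?s * d"
    using card_cut[OF finite_lessThan assms] d by (metis card_lessThan diff_add_inverse)
  ultimately show ?thesis by simp
qed

section \<open>Plays\<close>

text \<open>Take a longest history that continues \<open>h\<close> by \<open>s\<close>: if it did
  not exhaust \<open>X\<close>, one more move by \<open>s\<close> would lengthen it. Since
  \<open>s\<close> moves for both players, this turns a pair of strategies into an actual complete
  play.\<close>

lemma complete_play_extension:
  assumes fin: "finite X" and h: "history X h"
    and legal: "\<And>h. history X h \<Longrightarrow> set h \<noteq> X \<Longrightarrow> s h \<in> X - set h"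
  obtains p where "complete_play X p" "take (length h) p = h"
    "\<And>i. length h \<le> i \<Longrightarrow> i < length p \<Longrightarrow> p ! i = s (take i p)"
proof -
  define good where "good p \<longleftrightarrow> history X p \<and> take (length h) p = h \<and>
    (\<forall>i. length h \<le> i \<and> i < length p \<longrightarrow> p ! i = s (take i p))" for p
  have len: "length p \<le> card X" if "good p" for p
    using that card_mono[OF fin, of "set p"] distinct_card[of p] by (auto simp: good_def history_def)
  have "good h" using h by (auto simp: good_def)
  then obtain p where p: "good p" "\<And>q. good q \<Longrightarrow> length q \<le> length p"
    using ex_has_greatest_nat[of good h length "Suc (card X)"] len by (meson le_imp_less_Suc)
  have "set p = X"
  proof (rule ccontr)
    assume ne: "set p \<noteq> X"
    have "history X p" using p by (simp add: good_def)
    with ne legal have "s p \<in> X - set p" by blast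
    have le: "length h \<le> length p"
      using p(1) unfolding good_def by (metis length_take min.cobounded1)
    have "good (p @ [s p])"
      unfolding good_def
    proof (intro conjI allI impI)
      show "history X (p @ [s p])"
        using \<open>history X p\<close> \<open>s p \<in> X - set p\<close> by (simp add: history_def)
      show "take (length h) (p @ [s p]) = h" using p(1) le by (simp add: good_def)
      fix i assume i: "length h \<le> i \<and> i < length (p @ [s p])"
      show "(p @ [s p]) ! i = s (take i (p @ [s p]))"
      proof (cases "i = length p")
        case False
        with i p(1) show ?thesis by (simp add: good_def nth_append)
      qed simp
    qed
    with p(2) show False by fastforce
  qed
  with p(1) show thesis using that by (auto simp: good_def history_def complete_play_def)
qed

lemma length_complete_play: "complete_play X p \<Longrightarrow> length p = card X"
  by (metis complete_play_def distinct_card)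

text \<open>Positions count from 0, so the prefix of length \<open>2 * i + 1\<close> is what
  Enforcer sees when he answers Avoider's move at \<open>2 * i\<close>; hence \<open>Suc i\<close>
  and not \<open>i\<close>.\<close>

lemma avoider_claims_take:
  "avoider_claims (take (2 * i + 1) p) (Suc i) = avoider_claims p (Suc i)"
proof -
  have "take (2 * i + 1) p ! (2 * j) = p ! (2 * j)" if "j < Suc i" for j
    using that by (intro nth_take) linarith
  moreover have "2 * j < length (take (2 * i + 1) p) \<longleftrightarrow> 2 * j < length p" if "j < Suc i" for j
    using that by auto
  ultimately show ?thesis unfolding avoider_claims_def by (intro Collect_cong) metis
qed

section \<open>Enforcer's strategy\<close>

text \<open>For bipartite \<open>E\<close> these are the pairs of oppositely coloured vertices
  within one component of \<open>E\<close>. For non-bipartite \<open>E\<close> the condition is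
  vacuous and every pair is forced.\<close>

definition forced :: "'v set \<Rightarrow> 'v set set \<Rightarrow> 'v set set" where
  "forced V E = {e \<in> nsets V 2. \<forall>S\<subseteq>V. E \<subseteq> cut_edges V S \<longrightarrow> e \<in> cut_edges V S}"

text \<open>For bipartite \<open>E\<close> and vertices in \<open>V\<close> this is connectedness in
  \<open>E\<close>: a component fixes the relative sides of its vertices, while different components
  can be flipped independently. Stating it by cuts avoids paths.\<close>

definition linked :: "'v set \<Rightarrow> 'v set set \<Rightarrow> 'v \<Rightarrow> 'v \<Rightarrow> bool" where
  "linked V E u v \<longleftrightarrow>
     (\<forall>S\<subseteq>V. E \<subseteq> cut_edges V S \<longrightarrow> (u \<in> S \<longleftrightarrow> v \<in> S)) \<or>
     (\<forall>S\<subseteq>V. E \<subseteq> cut_edges V S \<longrightarrow> (u \<in> S \<longleftrightarrow> v \<notin> S))"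

lemma linked_refl: "linked V E u u"
  by (simp add: linked_def)

lemma linked_sym: "linked V E u v \<Longrightarrow> linked V E v u"
  unfolding linked_def by blast

lemma linked_trans: "linked V E u v \<Longrightarrow> linked V E v w \<Longrightarrow> linked V E u w"
  unfolding linked_def by (elim disjE) simp_all

lemma linked_mono: "linked V E u v \<Longrightarrow> E \<subseteq> E' \<Longrightarrow> linked V E' u v"
  unfolding linked_def by (elim disjE) (simp_all add: subset_trans[of E E'])

lemma forced_mono: "E \<subseteq> E' \<Longrightarrow> forced V E \<subseteq> forced V E'"
  unfolding forced_def by blast

text \<open>The least elements of the classes of \<^const>\<open>linked\<close>; they count the classes.\<close>

definition roots :: "nat set \<Rightarrow> nat set set \<Rightarrow> nat set" where
  "roots V E = {v \<in> V. \<forall>u\<in>V. u < v \<longrightarrow> \<not> linked V E u v}"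

lemma ex_root:
  assumes "u \<in> V"
  shows "\<exists>w\<in>roots V E. linked V E w u"
proof -
  let ?P = "\<lambda>w. w \<in> V \<and> linked V E w u"
  have P: "?P (LEAST w. ?P w)" by (rule LeastI[of ?P u]) (simp add: assms linked_refl)
  moreover have "\<not> linked V E x (LEAST w. ?P w)" if "x \<in> V" "x < (LEAST w. ?P w)" for x
    using that P not_less_Least[of x ?P] linked_trans[of V E x _ u] by blast
  ultimately have "(LEAST w. ?P w) \<in> roots V E" by (simp add: roots_def)
  with P show ?thesis by blast
qed

lemma roots_antimono: "E \<subseteq> E' \<Longrightarrow> roots V E' \<subseteq> roots V E"
  by (auto simp: roots_def dest: linked_mono)

text \<open>The classes of \<open>u\<close> and \<open>v\<close> have different roots under
  \<open>E\<close> but merge under \<open>E'\<close>, so the larger of these two roots is no longer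
  least in its class.\<close>

lemma roots_psubset:
  assumes "E \<subseteq> E'" "u \<in> V" "v \<in> V" "linked V E' u v" "\<not> linked V E u v"
  shows "roots V E' \<subset> roots V E"
proof -
  obtain a where a: "a \<in> roots V E" "linked V E a u" using ex_root assms by metis
  obtain b where b: "b \<in> roots V E" "linked V E b v" using ex_root assms by metis
  have ab: "a \<noteq> b" using a b assms(5) linked_sym linked_trans by metis
  have l: "linked V E' a b"
    using a(2) b(2) assms(1,4) by (meson linked_mono linked_sym linked_trans)
  have "a \<notin> roots V E' \<or> b \<notin> roots V E'"
    using ab l linked_sym[OF l] a(1) b(1) unfolding roots_def
    by (metis (no_types, lifting) linorder_neqE_nat mem_Collect_eq)
  then show ?thesis using a b roots_antimono[OF assms(1)] by blast
qed

text \<open>Some cut containing \<open>E\<close> leaves the ends of \<open>e\<close> together, as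
  \<open>e\<close> is not forced, and some cut separates them, as \<open>insert e E\<close> is
  bipartite. So they were not linked; once \<open>e\<close> is added, every cut separates them and
  their classes merge.\<close>

lemma roots_insert_psubset:
  assumes "e \<in> nsets V 2" "e \<notin> forced V E" "bipartite V (insert e E)"
  shows "roots V (insert e E) \<subset> roots V E"
proof -
  obtain u v where uv: "e = {u, v}" "u \<in> V" "v \<in> V"
    using assms(1) by (auto simp: nsets_def card_2_iff)
  obtain S where S: "S \<subseteq> V" "E \<subseteq> cut_edges V S" "{u, v} \<notin> cut_edges V S"
    using assms(1,2) uv(1) unfolding forced_def by blast
  obtain S' where S': "S' \<subseteq> V" "E \<subseteq> cut_edges V S'" "{u, v} \<in> cut_edges V S'"
    using assms(3) uv(1) unfolding bipartite_iff_cut by blast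
  note cut_iff = pair_in_cut_iff[OF uv(2,3)]
  have "\<not> linked V E u v"
    using S S' unfolding linked_def cut_iff by blast
  moreover have "linked V (insert e E) u v"
    unfolding linked_def uv(1) insert_subset cut_iff by blast
  ultimately show ?thesis using roots_psubset[OF _ uv(2,3)] by blast
qed

section \<open>Counting the rounds in which Enforcer has no forced answer\<close>

lemma card_strict_descents:
  fixes f :: "nat \<Rightarrow> nat"
  assumes "\<And>i. i < m \<Longrightarrow> f (Suc i) \<le> f i"
  shows "card {i. i < m \<and> f (Suc i) < f i} + f m \<le> f 0"
  using assms
proof (induction m)
  case (Suc m)
  have "{i. i < Suc m \<and> f (Suc i) < f i} =
      {i. i < m \<and> f (Suc i) < f i} \<union> (if f (Suc m) < f m then {m} else {})"
    by (auto simp: less_Suc_eq)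
  moreover have "finite {i. i < m \<and> f (Suc i) < f i}" by simp
  ultimately have "card {i. i < Suc m \<and> f (Suc i) < f i} =
      card {i. i < m \<and> f (Suc i) < f i} + (if f (Suc m) < f m then 1 else 0)"
    by (simp add: card_insert_if)
  moreover have "card {i. i < m \<and> f (Suc i) < f i} + f m \<le> f 0"
    using Suc.IH Suc.prems by simp
  ultimately show ?case using Suc.prems[of m] by (simp split: if_splits)
qed simp

text \<open>\<open>length h\<close> is a safe bound on the number of Avoider's moves in
  \<open>h\<close>, so all his edges so far are taken into account. The fallback to an arbitrary
  unclaimed edge keeps the strategy legal.\<close>

definition forcing_strategy :: "nat \<Rightarrow> nat set list \<Rightarrow> nat set" where
  "forcing_strategy n h =
     (let F = forced {..<n} (avoider_claims h (length h)) - set h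
      in SOME e. e \<in> (if F \<noteq> {} then F else complete_graph_edges n - set h))"

lemma forced_subset: "forced {..<n} E \<subseteq> complete_graph_edges n"
  by (auto simp: forced_def complete_graph_edges_def)

lemma enforcer_strategy_forcing:
  "enforcer_strategy (complete_graph_edges n) (forcing_strategy n)"
  unfolding enforcer_strategy_def
proof (intro allI impI)
  fix h assume h: "history (complete_graph_edges n) h \<and> odd (length h) \<and> set h \<noteq> complete_graph_edges n"
  let ?F = "forced {..<n} (avoider_claims h (length h)) - set h"
  let ?C = "if ?F \<noteq> {} then ?F else complete_graph_edges n - set h"
  have "?C \<noteq> {}" using h by (auto simp: history_def)
  then have "forcing_strategy n h \<in> ?C"
    unfolding forcing_strategy_def Let_def by (rule some_in_eq[THEN iffD2])
  then show "forcing_strategy n h \<in> complete_graph_edges n - set h"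
    using forced_subset by (auto split: if_splits)
qed

lemma forcing_strategy_forced:
  assumes "forced {..<n} (avoider_claims h (length h)) - set h \<noteq> {}"
  shows "forcing_strategy n h \<in> forced {..<n} (avoider_claims h (length h))"
proof -
  have "(SOME e. e \<in> forced {..<n} (avoider_claims h (length h)) - set h)
      \<in> forced {..<n} (avoider_claims h (length h)) - set h"
    using assms by (rule some_in_eq[THEN iffD2])
  with assms show ?thesis by (auto simp: forcing_strategy_def)
qed

lemma avoider_claims_all:
  "length h \<le> 2 * t \<Longrightarrow> avoider_claims h t = avoider_claims h (length h)"
proof -
  assume "length h \<le> 2 * t"
  then have "i < t \<and> 2 * i < length h \<longleftrightarrow> i < length h \<and> 2 * i < length h" for i by auto
  then show ?thesis by (simp only: avoider_claims_def)
qed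

lemma avoider_claims_Suc:
  assumes "2 * t < length p"
  shows "avoider_claims p (Suc t) = insert (p ! (2 * t)) (avoider_claims p t)"
  using assms unfolding avoider_claims_def by (auto simp: less_Suc_eq)

lemma avoider_claims_mono: "s \<le> t \<Longrightarrow> avoider_claims p s \<subseteq> avoider_claims p t"
  unfolding avoider_claims_def by (auto intro: order_less_le_trans)

lemma avoider_claims_subset: "avoider_claims p t \<subseteq> set p"
  unfolding avoider_claims_def by auto

text \<open>A cut containing Avoider's first \<open>m + 1\<close> edges also contains all but at
  most \<open>n\<close> of Enforcer's first \<open>m\<close> answers. So
  \<open>2 * m + 1 - n\<close> is at most a quarter of the square of \<open>n\<close>.\<close>

lemma forcing_strategy_bound:
  assumes p: "complete_play (complete_graph_edges n) p" "follows (forcing_strategy n) p"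
    and m: "2 * m < length p" and bip: "bipartite {..<n} (avoider_claims p (Suc m))"
  shows "8 * m + 4 \<le> n\<^sup>2 + 4 * n"
proof -
  let ?V = "{..<n}" and ?X = "complete_graph_edges n"
  define A where "A i = avoider_claims p (Suc i)" for i
  define f where "f i = card (roots ?V (A i))" for i
  \<comment> \<open>Round \<open>i\<close> is bad if Avoider's move after Enforcer's answer lowers
    the number of classes; there are at most \<open>n\<close> classes to lose.\<close>
  define bad where "bad = {i. i < m \<and> f (Suc i) < f i}"
  obtain S where S: "S \<subseteq> ?V" "A m \<subseteq> cut_edges ?V S"
    using bip unfolding A_def bipartite_iff_cut by blast
  have fin_roots: "finite (roots ?V E)" for E by (simp add: roots_def)
  have A_mono: "A i \<subseteq> A j" if "i \<le> j" for i j
    unfolding A_def using that by (intro avoider_claims_mono) simp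
  have f_mono: "f (Suc i) \<le> f i" for i
    unfolding f_def by (intro card_mono fin_roots roots_antimono A_mono) simp
  have "card bad + f m \<le> f 0"
    unfolding bad_def by (rule card_strict_descents) (rule f_mono)
  moreover have "f 0 \<le> n"
    unfolding f_def using card_mono[of ?V "roots ?V (A 0)"] by (auto simp: roots_def)
  ultimately have bad: "card bad \<le> n" by simp
  have dist: "distinct p" and setp: "set p = ?X" using p(1) by (auto simp: complete_play_def)
  have good: "p ! (2 * i + 1) \<in> cut_edges ?V S" if i: "i < m" "i \<notin> bad" for i
  proof -
    let ?h = "take (2 * i + 1) p"
    have claims: "avoider_claims ?h (length ?h) = A i"
    proof -
      have "avoider_claims ?h (length ?h) = avoider_claims ?h (Suc i)"
        by (rule avoider_claims_all[symmetric]) simp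
      also have "\<dots> = A i" unfolding A_def by (rule avoider_claims_take)
      finally show ?thesis .
    qed
    have lt: "2 * Suc i < length p" using i m unfolding mult_Suc_right by linarith
    have step: "A (Suc i) = insert (p ! (2 * Suc i)) (A i)"
      unfolding A_def using lt by (rule avoider_claims_Suc)
    \<comment> \<open>Otherwise Avoider's next edge, unclaimed at this point, would not be forced;
      it would merge two classes and make the round bad.\<close>
    have "forced ?V (A i) - set ?h \<noteq> {}"
    proof
      assume none: "forced ?V (A i) - set ?h = {}"
      have "p ! (2 * Suc i) \<notin> set ?h"
        using dist lt by (auto simp: in_set_conv_nth nth_eq_iff_index_eq)
      then have nf: "p ! (2 * Suc i) \<notin> forced ?V (A i)" using none by blast
      have "p ! (2 * Suc i) \<in> nsets ?V 2"
        using setp lt nth_mem unfolding complete_graph_edges_def by blast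
      moreover have "bipartite ?V (A (Suc i))"
        using bip bipartite_subset A_mono[of "Suc i" m] i unfolding A_def by auto
      ultimately have "roots ?V (A (Suc i)) \<subset> roots ?V (A i)"
        using nf roots_insert_psubset unfolding step by blast
      then have "f (Suc i) < f i" unfolding f_def by (intro psubset_card_mono fin_roots)
      with i show False by (simp add: bad_def)
    qed
    then have "forcing_strategy n ?h \<in> forced ?V (A i)"
      using forcing_strategy_forced[of n ?h] unfolding claims by blast
    moreover have "p ! (2 * i + 1) = forcing_strategy n ?h"
      using p(2) lt by (simp add: follows_def)
    ultimately show ?thesis
      using S forced_mono[OF A_mono[of i m], of ?V] i unfolding forced_def by auto
  qed
  \<comment> \<open>Positions of the play whose edges are known to lie in the cut: all of Avoider's
    moves (even) and Enforcer's answers in the good rounds (odd).\<close>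
  define J where "J = (\<lambda>i. 2 * i) ` {..m} \<union> (\<lambda>i. 2 * i + 1) ` ({..<m} - bad)"
  have Jlt: "J \<subseteq> {..<length p}" using m by (auto simp: J_def)
  have fin_bad: "finite bad" "bad \<subseteq> {..<m}" by (auto simp: bad_def)
  have "(\<lambda>i. 2 * i) ` {..m} \<inter> (\<lambda>i. 2 * i + 1) ` ({..<m} - bad) = {}"
    by auto presburger
  then have "card J = card ((\<lambda>i::nat. 2 * i) ` {..m}) + card ((\<lambda>i. 2 * i + 1) ` ({..<m} - bad))"
    unfolding J_def by (intro card_Un_disjoint) auto
  also have "card ((\<lambda>i::nat. 2 * i) ` {..m}) = Suc m"
    by (subst card_image) (auto simp: inj_on_def)
  also have "card ((\<lambda>i. 2 * i + 1) ` ({..<m} - bad)) = m - card bad"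
    using fin_bad by (subst card_image) (auto simp: inj_on_def card_Diff_subset)
  finally have cardJ: "2 * m + 1 \<le> card J + n" using bad by linarith
  have "(!) p ` J \<subseteq> cut_edges ?V S"
  proof -
    have "p ! (2 * i) \<in> A m" if "i \<le> m" for i
      using that m unfolding A_def avoider_claims_def by fastforce
    then show ?thesis using S(2) good unfolding J_def by auto
  qed
  moreover have "finite (cut_edges ?V S)"
    using S(1) by (simp add: cut_edges_def finite_subset)
  moreover have "inj_on ((!) p) J"
    using Jlt dist by (intro inj_on_nth) auto
  ultimately have "card J \<le> card (cut_edges ?V S)"
    by (metis card_image card_mono)
  then show ?thesis using card_cut_le[OF S(1)] cardJ by linarith
qed

text \<open>Contrapositive of the bound: Avoider's graph itself is the losing set. The second
  hypothesis ensures that the board is large enough for the move at position \<open>2 * m\<close> to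
  take place.\<close>

lemma enforcer_wins_within_NC2:
  assumes "n\<^sup>2 + 4 * n < 8 * m + 4" "2 * m < n choose 2"
  shows "enforcer_wins_within (complete_graph_edges n) (NC2 n) (Suc m)"
proof -
  have "\<exists>H\<in>NC2 n. H \<subseteq> avoider_claims p (Suc m)"
    if p: "complete_play (complete_graph_edges n) p" "follows (forcing_strategy n) p" for p
  proof -
    have "2 * m < length p"
      using assms(2) p(1) by (simp add: length_complete_play card_complete_graph_edges)
    with forcing_strategy_bound[OF p] assms(1)
    have "\<not> bipartite {..<n} (avoider_claims p (Suc m))" by fastforce
    moreover have "avoider_claims p (Suc m) \<subseteq> complete_graph_edges n"
      using avoider_claims_subset[of p "Suc m"] p(1) by (simp add: complete_play_def)
    ultimately show ?thesis by (auto simp: NC2_def)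
  qed
  with enforcer_strategy_forcing show ?thesis
    unfolding enforcer_wins_within_def by blast
qed

section \<open>Avoider's strategy\<close>

lemma nsets_2_cases:
  assumes "e \<in> nsets V 2"
  obtains a b where "e = {a, b}" "a \<in> V" "b \<in> V" "a \<noteq> b"
  using assms by (auto simp: nsets_def card_2_iff)

lemma card_Union_nsets_2:
  assumes "E \<subseteq> nsets V 2" "finite E"
  shows "card (\<Union>E) \<le> 2 * card E"
proof -
  have "card (\<Union>E) \<le> sum card E"
    using card_UN_le[OF assms(2), of id] by simp
  also have "\<dots> = (\<Sum>e\<in>E. 2)"
    using assms(1) by (intro sum.cong) (auto simp: nsets_def)
  finally show ?thesis by simp
qed

text \<open>An Enforcer edge through \<open>0\<close> ends outside the star's leaves. So either the other
  Enforcer edges can be put on the side of the leaves, or the ones through \<open>0\<close> on the side of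
  \<open>0\<close>; all remaining vertices are free to balance the cut.\<close>

lemma balanced_cut_of_star:
  assumes A: "A \<subseteq> (\<lambda>x. {0, x}) ` {1..<n}" and E: "E \<subseteq> nsets {..<n} 2"
    and disj: "A \<inter> E = {}" and card: "card A = r" "card E = r" and r: "8 * r \<le> n" "2 \<le> n"
  obtains S where "S \<subseteq> {..<n}" "card S = n div 2" "A \<subseteq> cut_edges {..<n} S"
    "r \<le> 2 * card (E - cut_edges {..<n} S)"
proof -
  define L where "L = {x \<in> {1..<n}. {0, x} \<in> A}"
  have A_L: "A = (\<lambda>x. {0, x}) ` L" using A by (auto simp: L_def)
  have "card L = r"
    using card(1) unfolding A_L by (subst (asm) card_image) (auto simp: inj_on_def doubleton_eq_iff)
  have finL: "finite L" by (simp add: L_def)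
  have finE: "finite E" using E finite_imp_finite_nsets[of "{..<n}" 2] finite_subset by blast
  define E0 where "E0 = {e \<in> E. 0 \<in> e}"
  define E1 where "E1 = {e \<in> E. 0 \<notin> e}"
  have sub: "E0 \<subseteq> E" "E1 \<subseteq> E" by (auto simp: E0_def E1_def)
  have fin01: "finite E0" "finite E1" using sub finE finite_subset by auto
  have "E = E0 \<union> E1" "E0 \<inter> E1 = {}" by (auto simp: E0_def E1_def)
  then have "card E0 + card E1 = r" using card(2) card_Un_disjoint[OF fin01] by simp
  \<comment> \<open>One of the two kinds makes up at least half of \<open>E\<close>. In either case
    all edges of that kind are placed inside \<open>S\<close>, hence off the cut.\<close>
  then consider "r \<le> 2 * card E1" "card E1 \<le> r" | "r \<le> 2 * card E0" "card E0 \<le> r" by linarith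
  then show thesis
  proof cases
    case 1
    have "card (\<Union>E1) \<le> 2 * r"
      using card_Union_nsets_2[of E1 "{..<n}"] sub E fin01 1 by fastforce
    \<comment> \<open>The leaves and the ends of \<open>E1\<close> are at most \<open>3 * r\<close>
      vertices, none of them 0, so \<open>S\<close> can contain them all and leave 0
      outside.\<close>
    then have "card (L \<union> \<Union>E1) \<le> n div 2"
      using card_Un_le[of L "\<Union>E1"] \<open>card L = r\<close> r by linarith
    moreover have "L \<union> \<Union>E1 \<subseteq> {1..<n}"
    proof -
      have "x \<noteq> 0 \<and> x < n" if "e \<in> E1" "x \<in> e" for e x
        using that E by (auto simp: E1_def nsets_def intro!: Nat.gr0I)
      then show ?thesis by (fastforce simp: L_def)
    qed
    moreover have "n div 2 \<le> card {1..<n}" using r by simp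
    ultimately obtain S where S: "L \<union> \<Union>E1 \<subseteq> S" "S \<subseteq> {1..<n}" "card S = n div 2"
      using exists_subset_between[of "L \<union> \<Union>E1" "n div 2" "{1..<n}"] by auto
    have "A \<subseteq> cut_edges {..<n} S"
    proof -
      have "{0, x} \<in> cut_edges {..<n} S" if "x \<in> L" for x
      proof -
        have "x < n" "0 < n" "x \<in> S" "0 \<notin> S" using that S(1,2) r by (auto simp: L_def)
        then show ?thesis by (simp add: pair_in_cut_iff)
      qed
      then show ?thesis unfolding A_L by blast
    qed
    moreover have "E1 \<subseteq> E - cut_edges {..<n} S"
    proof
      fix e assume e: "e \<in> E1"
      then obtain a b where "e = {a, b}" "a \<in> {..<n}" "b \<in> {..<n}"
        using sub E by (meson nsets_2_cases subsetD)
      with e S(1) show "e \<in> E - cut_edges {..<n} S" using sub by (auto simp: pair_in_cut_iff)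
    qed
    then have "card E1 \<le> card (E - cut_edges {..<n} S)" using finE by (intro card_mono) auto
    moreover have "S \<subseteq> {..<n}" using S(2) by auto
    moreover have "r \<le> 2 * card (E - cut_edges {..<n} S)"
      using 1(1) \<open>card E1 \<le> card (E - cut_edges {..<n} S)\<close> by linarith
    ultimately show thesis using that S(3) by blast
  next
    case 2
    have "card (\<Union>E0) \<le> 2 * r"
      using card_Union_nsets_2[of E0 "{..<n}"] sub E fin01 2 by fastforce
    \<comment> \<open>Here \<open>S\<close> is to contain 0 and the ends of \<open>E0\<close> but no
      leaf. For \<open>r = 0\<close> the room for 0 comes from \<open>2 \<le> n\<close>.\<close>
    moreover have "Suc (2 * r) \<le> n div 2" using r by presburger
    ultimately have "card (insert 0 (\<Union>E0)) \<le> n div 2"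
      using card_insert_le_m1[of "Suc (2 * r)" "\<Union>E0" 0] by simp
    moreover have "insert 0 (\<Union>E0) \<subseteq> {..<n} - L"
    proof -
      have "x < n \<and> x \<notin> L" if e: "e \<in> E0" "x \<in> e" for e x
      proof
        obtain a b where ab: "e = {a, b}" "a \<in> {..<n}" "b \<in> {..<n}"
          using e sub E by (meson nsets_2_cases subsetD)
        with e show "x < n" by auto
        show "x \<notin> L"
        proof
          assume x: "x \<in> L"
          then have "e = {0, x}" using ab e by (auto simp: L_def E0_def)
          with x e sub disj show False by (auto simp: L_def)
        qed
      qed
      moreover have "0 < n" "0 \<notin> L" using r by (auto simp: L_def)
      ultimately show ?thesis by auto
    qed
    moreover have "n div 2 \<le> card ({..<n} - L)"
      using diff_card_le_card_Diff[OF finL, of "{..<n}"] r \<open>card L = r\<close> by simp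
    ultimately obtain S where S: "insert 0 (\<Union>E0) \<subseteq> S" "S \<subseteq> {..<n} - L" "card S = n div 2"
      using exists_subset_between[of "insert 0 (\<Union>E0)" "n div 2" "{..<n} - L"] by auto
    have "A \<subseteq> cut_edges {..<n} S"
    proof -
      have "{0, x} \<in> cut_edges {..<n} S" if "x \<in> L" for x
      proof -
        have "x < n" "0 < n" "x \<notin> S" "0 \<in> S" using that S(1,2) r by (auto simp: L_def)
        then show ?thesis by (simp add: pair_in_cut_iff)
      qed
      then show ?thesis unfolding A_L by blast
    qed
    moreover have "E0 \<subseteq> E - cut_edges {..<n} S"
    proof
      fix e assume e: "e \<in> E0"
      then obtain a b where "e = {a, b}" "a \<in> {..<n}" "b \<in> {..<n}"
        using sub E by (meson nsets_2_cases subsetD)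
      with e S(1) show "e \<in> E - cut_edges {..<n} S" using sub by (auto simp: pair_in_cut_iff)
    qed
    then have "card E0 \<le> card (E - cut_edges {..<n} S)" using finE by (intro card_mono) auto
    moreover have "S \<subseteq> {..<n}" using S(2) by auto
    moreover have "r \<le> 2 * card (E - cut_edges {..<n} S)"
      using 2(1) \<open>card E0 \<le> card (E - cut_edges {..<n} S)\<close> by linarith
    ultimately show thesis using that S(3) by blast
  qed
qed

text \<open>One function moves for both players, in the form that
  \<open>complete_play_extension\<close> expects. When \<open>C\<close> is exhausted, Avoider takes
  any unclaimed element, so the move stays legal.\<close>

definition claim_from :: "'a set \<Rightarrow> 'a set \<Rightarrow> ('a list \<Rightarrow> 'a) \<Rightarrow> 'a list \<Rightarrow> 'a" where
  "claim_from X C \<sigma> h =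
     (if odd (length h) then \<sigma> h
      else SOME e. e \<in> (if C - set h \<noteq> {} then C - set h else X - set h))"

text \<open>The starting history is arbitrary so that Avoider can change his target during the game:
  first the star, from the empty history, then a cut, from the position reached.\<close>

lemma play_claiming_from:
  assumes fin: "finite X" and C: "C \<subseteq> X" and \<sigma>: "enforcer_strategy X \<sigma>"
    and h: "history X h" "follows \<sigma> h"
  obtains p where "complete_play X p" "take (length h) p = h" "follows \<sigma> p"
    "\<And>i. length h \<le> 2 * i \<Longrightarrow> 2 * i < length p \<Longrightarrow> \<not> C \<subseteq> set (take (2 * i) p) \<Longrightarrow> p ! (2 * i) \<in> C"
proof -
  have some: "(SOME e. e \<in> B) \<in> B" if "B \<noteq> {}" for B :: "'a set"
    using that by (rule some_in_eq[THEN iffD2])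
  have "claim_from X C \<sigma> g \<in> X - set g" if "history X g" "set g \<noteq> X" for g
  proof (cases "odd (length g)")
    case True
    with that \<sigma> show ?thesis by (simp add: claim_from_def enforcer_strategy_def)
  next
    case False
    let ?B = "if C - set g \<noteq> {} then C - set g else X - set g"
    have "?B \<noteq> {}" using that by (auto simp: history_def)
    from some[OF this] False C show ?thesis by (auto simp: claim_from_def split: if_splits)
  qed
  from complete_play_extension[OF fin h(1) this] obtain p where
    p: "complete_play X p" "take (length h) p = h"
    "\<And>i. length h \<le> i \<Longrightarrow> i < length p \<Longrightarrow> p ! i = claim_from X C \<sigma> (take i p)" by blast
  have "follows \<sigma> p"
    unfolding follows_def
  proof (intro allI impI)
    fix i assume i: "i < length p" "odd i"
    show "p ! i = \<sigma> (take i p)"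
    proof (cases "i < length h")
      case True
      then have "p ! i = h ! i" "take i p = take i h"
        using p(2) by (metis nth_take, metis less_imp_le min.absorb1 take_take)
      with True h(2) i show ?thesis by (simp add: follows_def)
    next
      case False
      with p(3)[of i] i show ?thesis by (simp add: claim_from_def)
    qed
  qed
  moreover have "p ! (2 * i) \<in> C"
    if "length h \<le> 2 * i" "2 * i < length p" "\<not> C \<subseteq> set (take (2 * i) p)" for i
  proof -
    have ne: "C - set (take (2 * i) p) \<noteq> {}" using that(3) by blast
    have "p ! (2 * i) = claim_from X C \<sigma> (take (2 * i) p)" using p(3) that by blast
    also have "\<dots> = (SOME e. e \<in> C - set (take (2 * i) p))"
      using ne that by (simp add: claim_from_def)
    finally show ?thesis using some[OF ne] by simp
  qed
  ultimately show thesis using that p by blast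
qed

section \<open>Avoider's two stages: a star, then a balanced cut\<close>

lemma history_take: "complete_play X p \<Longrightarrow> history X (take k p)"
  using set_take_subset by (fastforce simp: complete_play_def history_def)

lemma follows_take: "follows \<sigma> p \<Longrightarrow> follows \<sigma> (take k p)"
  by (auto simp: follows_def min_def)

text \<open>Avoider can stay in the cut until all its edges are claimed, and at least
  \<open>r / 2\<close> of Enforcer's claims are spent outside it. The summand 4 appears because his
  last move has index \<open>t - 1\<close>.\<close>

lemma avoider_keeps_bipartite:
  assumes \<sigma>: "enforcer_strategy (complete_graph_edges n) \<sigma>"
    and r: "8 * r \<le> n" "2 \<le> n"
    and t: "4 * t < 2 * ((n div 2) * (n - n div 2)) + r + 4"
  obtains p where "complete_play (complete_graph_edges n) p" "follows \<sigma> p"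
    "bipartite {..<n} (avoider_claims p t)"
proof -
  let ?X = "complete_graph_edges n"
  let ?V = "{..<n}"
  define star where "star = (\<lambda>x. {0, x}) ` {1..<n}"
  have star_X: "star \<subseteq> ?X" by (auto simp: star_def complete_graph_edges_def nsets_def)
  have card_star: "card star = n - 1"
    unfolding star_def by (subst card_image) (auto simp: inj_on_def doubleton_eq_iff)
  have "history ?X []" "follows \<sigma> []" by (simp_all add: history_def follows_def)
  \<comment> \<open>Only the first \<open>2 * r\<close> positions of \<open>p1\<close> matter: they
    reveal how \<open>\<sigma>\<close> answers the star.\<close>
  then obtain p1 where p1: "complete_play ?X p1" "follows \<sigma> p1"
    "\<And>i. 2 * i < length p1 \<Longrightarrow> \<not> star \<subseteq> set (take (2 * i) p1) \<Longrightarrow> p1 ! (2 * i) \<in> star"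
    using play_claiming_from[OF finite_complete_graph_edges star_X \<sigma>] by (metis list.size(3) zero_le)
  have "n - 1 \<le> length p1"
    using card_mono[OF finite_complete_graph_edges star_X] card_star p1(1)
    by (simp add: length_complete_play)
  moreover have "2 * r \<le> n - 1" using r by linarith
  ultimately have len1: "2 * r \<le> length p1" by linarith
  have dist1: "distinct p1" using p1(1) by (simp add: complete_play_def)
  define A where "A = (\<lambda>i. p1 ! (2 * i)) ` {..<r}"
  define E where "E = (\<lambda>i. p1 ! (2 * i + 1)) ` {..<r}"
  have "p1 ! (2 * i) \<in> star" if "i < r" for i
  proof (rule p1(3))
    show "2 * i < length p1" using that len1 by linarith
    show "\<not> star \<subseteq> set (take (2 * i) p1)"
    proof
      assume "star \<subseteq> set (take (2 * i) p1)"
      then have "n - 1 \<le> card (set (take (2 * i) p1))"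
        using card_star by (metis List.finite_set card_mono)
      also have "\<dots> \<le> 2 * i" by (metis card_length le_trans length_take min.cobounded2)
      finally show False using that r by linarith
    qed
  qed
  then have A: "A \<subseteq> star" by (auto simp: A_def)
  have E: "E \<subseteq> nsets ?V 2"
    using p1(1) len1 nth_mem by (fastforce simp: E_def complete_play_def complete_graph_edges_def)
  have disj: "A \<inter> E = {}"
  proof -
    have "p1 ! (2 * i) \<noteq> p1 ! (2 * j + 1)" if "i < r" "j < r" for i j
    proof -
      have "2 * i \<noteq> 2 * j + 1" by presburger
      then show ?thesis using that len1 dist1 by (simp add: nth_eq_iff_index_eq)
    qed
    then show ?thesis unfolding A_def E_def by blast
  qed
  have cA: "card A = r" unfolding A_def
    by (subst card_image) (use len1 dist1 in \<open>auto simp: inj_on_def nth_eq_iff_index_eq\<close>)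
  have cE: "card E = r" unfolding E_def
    by (subst card_image) (use len1 dist1 in \<open>auto simp: inj_on_def nth_eq_iff_index_eq\<close>)
  obtain S where S: "S \<subseteq> ?V" "card S = n div 2" "A \<subseteq> cut_edges ?V S" "r \<le> 2 * card (E - cut_edges ?V S)"
    using balanced_cut_of_star[OF A[unfolded star_def] E disj cA cE r] by blast
  \<comment> \<open>The cut depends on Enforcer's edges \<open>E\<close>, so it is known only after
    the first stage; the play is then restarted from \<open>h\<close> with the cut as
    target.\<close>
  define h where "h = take (2 * r) p1"
  have lenh: "length h = 2 * r" using len1 by (simp add: h_def)
  have cut_X: "cut_edges ?V S \<subseteq> ?X" using cut_subset_nsets[OF S(1)] by (simp add: complete_graph_edges_def)
  obtain p where p: "complete_play ?X p" "take (length h) p = h" "follows \<sigma> p"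
    "\<And>i. length h \<le> 2 * i \<Longrightarrow> 2 * i < length p \<Longrightarrow> \<not> cut_edges ?V S \<subseteq> set (take (2 * i) p)
       \<Longrightarrow> p ! (2 * i) \<in> cut_edges ?V S"
    using play_claiming_from[OF finite_complete_graph_edges cut_X \<sigma>
        history_take[OF p1(1), of "2 * r"] follows_take[OF p1(2), of "2 * r"]]
    unfolding h_def by blast
  have p_p1: "p ! j = p1 ! j" if "j < 2 * r" for j
    using p(2) lenh that unfolding h_def by (metis nth_take)
  have "p ! (2 * i) \<in> cut_edges ?V S" if i: "i < t" "2 * i < length p" for i
  proof (cases "i < r")
    case True
    then show ?thesis using S(3) p_p1[of "2 * i"] by (auto simp: A_def)
  next
    case False
    show ?thesis
    proof (rule p(4))
      show "length h \<le> 2 * i" "2 * i < length p" using False i lenh by auto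
      show "\<not> cut_edges ?V S \<subseteq> set (take (2 * i) p)"
      proof
        assume "cut_edges ?V S \<subseteq> set (take (2 * i) p)"
        moreover have "E \<subseteq> set (take (2 * i) p)"
        proof
          fix e assume "e \<in> E"
          then obtain j where j: "j < r" "e = p ! (2 * j + 1)" using p_p1 by (auto simp: E_def)
          then have "2 * j + 1 < length (take (2 * i) p)" using False i by simp
          moreover from this have "take (2 * i) p ! (2 * j + 1) = e"
            using j(2) by simp
          ultimately show "e \<in> set (take (2 * i) p)" using nth_mem by metis
        qed
        \<comment> \<open>If the cut were exhausted, the first \<open>2 * i\<close> claims would
          comprise the whole cut and also the edges of \<open>E\<close> off it, which is too
          many.\<close>
        ultimately have "card (cut_edges ?V S \<union> (E - cut_edges ?V S)) \<le> card (set (take (2 * i) p))"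
          by (intro card_mono) auto
        also have "\<dots> \<le> 2 * i" by (metis card_length le_trans length_take min.cobounded2)
        also have "card (cut_edges ?V S \<union> (E - cut_edges ?V S)) = card (cut_edges ?V S) + card (E - cut_edges ?V S)"
          using finite_subset[OF cut_X finite_complete_graph_edges]
          by (intro card_Un_disjoint) (auto simp: E_def)
        finally have "2 * (card (cut_edges ?V S) + card (E - cut_edges ?V S)) \<le> 4 * i" by simp
        with t i S(2,4) card_cut[OF _ S(1)] show False by simp
      qed
    qed
  qed
  then have "avoider_claims p t \<subseteq> cut_edges ?V S" by (auto simp: avoider_claims_def)
  with S(1) p show thesis using that unfolding bipartite_iff_cut by blast
qed

section \<open>Numerical bounds and the value of the game\<close>

lemma enforcer_wins_within_lower_bound:
  assumes win: "enforcer_wins_within (complete_graph_edges n) (NC2 n) t" and n: "2 \<le> n"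
  shows "(real n)\<^sup>2 / 8 + 1 / 32 * real n \<le> real t"
proof -
  define r where "r = n div 8"
  define q where "q = (n div 2) * (n - n div 2)"
  obtain \<sigma> where \<sigma>: "enforcer_strategy (complete_graph_edges n) \<sigma>"
    "\<And>p. complete_play (complete_graph_edges n) p \<Longrightarrow> follows \<sigma> p \<Longrightarrow>
      \<exists>H\<in>NC2 n. H \<subseteq> avoider_claims p t"
    using win unfolding enforcer_wins_within_def by blast
  have "2 * q + r + 4 \<le> 4 * t"
  proof (rule ccontr)
    assume "\<not> ?thesis"
    then have "4 * t < 2 * q + r + 4" by simp
    moreover have "8 * r \<le> n" by (simp add: r_def)
    ultimately obtain p where p: "complete_play (complete_graph_edges n) p" "follows \<sigma> p"
      "bipartite {..<n} (avoider_claims p t)"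
      using avoider_keeps_bipartite[OF \<sigma>(1)] n unfolding q_def by metis
    from \<sigma>(2)[OF p(1,2)] p(3) show False by (auto simp: NC2_def dest: bipartite_subset)
  qed
  then have "2 * real q + real r + 4 \<le> 4 * real t" by linarith
  moreover have "n\<^sup>2 \<le> 4 * q + 1"
  proof (cases "even n")
    case True
    then obtain k where "n = 2 * k" by blast
    then show ?thesis by (simp add: q_def power2_eq_square)
  next
    case False
    then obtain k where "n = 2 * k + 1" by (rule oddE)
    then show ?thesis by (simp add: q_def power2_eq_square)
  qed
  then have "(real n)\<^sup>2 \<le> 4 * real q + 1"
    by (metis (mono_tags) of_nat_1 of_nat_add of_nat_le_iff of_nat_mult of_nat_numeral of_nat_power)
  moreover have "n \<le> 8 * r + 7" unfolding r_def by linarith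
  then have "real n \<le> 8 * real r + 7" by linarith
  \<comment> \<open>The coefficient 1/32 is 1/4 from the weight of \<open>r\<close> times 1/8 from
    its size; the rounding losses 1/8 and 7/32 are covered by the summand 1 in the bound on
    \<open>t\<close>.\<close>
  ultimately show ?thesis by simp
qed

theorem theorem2:
  "\<exists>c1 c2 :: real. c1 > 0 \<and> c2 > 0 \<and>
     (\<forall>\<^sub>F n in sequentially.
        ereal ((real n)\<^sup>2 / 8 + c1 * real n) \<le> ereal_of_enat (tau_E (complete_graph_edges n) (NC2 n)) \<and>
        ereal_of_enat (tau_E (complete_graph_edges n) (NC2 n)) \<le> ereal ((real n)\<^sup>2 / 8 + c2 * real n))"
proof (intro exI conjI)
  \<comment> \<open>The upper bound exceeds the main term by at most \<open>n / 2 + 2\<close>, which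
    the constant 1 absorbs for large \<open>n\<close>.\<close>
  show "(1 / 32 :: real) > 0" "(1 :: real) > 0" by simp_all
  show "\<forall>\<^sub>F n in sequentially.
        ereal ((real n)\<^sup>2 / 8 + 1 / 32 * real n) \<le> ereal_of_enat (tau_E (complete_graph_edges n) (NC2 n)) \<and>
        ereal_of_enat (tau_E (complete_graph_edges n) (NC2 n)) \<le> ereal ((real n)\<^sup>2 / 8 + 1 * real n)"
    using eventually_ge_at_top[of 20]
  proof eventually_elim
    case (elim n)
    let ?W = "{t. enforcer_wins_within (complete_graph_edges n) (NC2 n) t}"
    \<comment> \<open>With this quotient rounded down, \<open>Suc m\<close> satisfies the inequality
      required for Enforcer's win.\<close>
    define m where "m = (n\<^sup>2 + 4 * n) div 8"
    have m: "8 * m \<le> n\<^sup>2 + 4 * n" "n\<^sup>2 + 4 * n < 8 * m + 8" unfolding m_def by linarith+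
    have "20 * n \<le> n\<^sup>2" using elim by (simp add: power2_eq_square)
    moreover have "2 * (n choose 2) + n = n\<^sup>2"
      by (simp add: choose_two power2_eq_square diff_mult_distrib2)
    ultimately have "2 * Suc m < n choose 2" using m elim unfolding mult_Suc_right by linarith
    then have win: "enforcer_wins_within (complete_graph_edges n) (NC2 n) (Suc (Suc m))"
      using m by (intro enforcer_wins_within_NC2) auto
    \<comment> \<open>Enforcer wins within some finite time, so the infimum is attained at a natural
      number.\<close>
    define T where "T = (LEAST t. t \<in> ?W)"
    have T: "T \<in> ?W" "T \<le> Suc (Suc m)"
      using win unfolding T_def by (metis LeastI mem_Collect_eq, simp add: Least_le)
    have "{enat t | t. enforcer_wins_within (complete_graph_edges n) (NC2 n) t} = enat ` ?W"
      by blast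
    moreover have "Inf (enat ` ?W) = enat T"
      by (rule antisym) (use T(1) in \<open>auto intro!: Inf_lower Inf_greatest simp: T_def Least_le\<close>)
    ultimately have tau: "tau_E (complete_graph_edges n) (NC2 n) = enat T"
      unfolding tau_E_def by simp
    have "(real n)\<^sup>2 / 8 + 1 / 32 * real n \<le> real T"
      using enforcer_wins_within_lower_bound T(1) elim by simp
    moreover have "real T \<le> (real n)\<^sup>2 / 8 + real n"
    proof -
      have "8 * T \<le> n\<^sup>2 + 8 * n" using m(1) T(2) elim by linarith
      then have "8 * real T \<le> (real n)\<^sup>2 + 8 * real n"
        by (metis (mono_tags) of_nat_add of_nat_le_iff of_nat_mult of_nat_numeral of_nat_power)
      then show ?thesis by simp
    qed
    ultimately show ?case unfolding tau by simp
  qed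
qed

end
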